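(* Let $n\equiv1\pmod4$, $n\ge5$, and put $m=\frac{n+1}{2}$ (an odd integer). For $X\in M_n(\mathbb{C})$ let $\tilde X=\begin{pmatrix}0&0\\ 0&X\end{pmatrix}\in M_{n+1}(\mathbb{C})$ be $X$ padded with a zero first row and a zero first column, viewed as an $m\times m$ matrix of $2\times2$ blocks $\tilde X_{(p,q)}$, $1\le p,q\le m$. The solutions $X$ of $X^tA_n^2+A_n^2X=0$ are exactly those $X$ for which $\tilde X$ has the following form, for arbitrary complex parameters $x_{1,1},x_{2,2},x_{2,3}$, $x_{1,i},x_{1,i+1}$ ($i=2+4k$, $0\le k\le\frac{n-5}{4}$), $x_{2,j},x_{2,j+1}$ ($j=6+4k$, $0\le k\le\frac{n-9}{4}$): putting $$X_{11}=\begin{pmatrix}0&0\\ 0&x_{1,1}\end{pmatrix},\quad X_{2,2}=\begin{pmatrix}x_{2,2}&x_{2,3}\\ 0&-x_{1,1}\end{pmatrix},\quad Y_{1,i}=\begin{pmatrix}0&0\\ x_{1,i}&x_{1,i+1}\end{pmatrix},\quad Y_{2,j}=\begin{pmatrix}x_{2,j}&x_{2,j+1}\\ 0&0\end{pmatrix},$$ one has - $\tilde X_{(1,1)}=X_{11}$; $\tilde X_{(p,p)}=X_{2,2}$ for $p$ even; $\tilde X_{(p,p)}=-X_{2,2}^t$ for $p\ge3$ odd; - $\tilde X_{(p,q)}=Y_{1,2(q-p)}$ for $p$ odd, $q$ even, $p<q$; - $\tilde X_{(p,q)}=-Y_{1,2(p-q)}^t$ for $p$ odd, $q$ even, $p>q$;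 - $\tilde X_{(p,q)}=Y_{2,2(q-p)+2}$ for $p,q$ even, $p<q$; - $\tilde X_{(p,q)}=-Y_{2,2(p-q)+2}^t$ for $p,q$ odd, $p>q\ge3$; - $\tilde X_{(p,q)}=0$ in all other cases.
   Context: $A_n$ is the $n\times n$ matrix with $(A_n)_{i,i+1}=1$ for $1\le i\le n-1$ and zeros elsewhere; $A_n^2$ is its square, so $(A_n^2)_{i,i+2}=1$ for $1\le i\le n-2$ and all other entries are $0$. Index ranges with negative upper bound are empty. *)

theory Defs
  imports Complex_Main "Jordan_Normal_Form.Matrix"
begin

text \<open>Matrix entries are indexed from 0 in the library. The indices \<open>p, q\<close> of 2-by-2 blocks and the
  two indices of the parameters \<open>x\<close> below start at 1.\<close>

definition shift_mat :: "nat \<Rightarrow> complex mat" where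
  "shift_mat n = mat n n (\<lambda>(i, j). if j = i + 1 then 1 else 0)"

definition pad_mat :: "nat \<Rightarrow> complex mat \<Rightarrow> complex mat" where
  "pad_mat n X = four_block_mat (0\<^sub>m 1 1) (0\<^sub>m 1 n) (0\<^sub>m n 1) X"

definition block2 :: "complex mat \<Rightarrow> nat \<Rightarrow> nat \<Rightarrow> complex mat" where
  "block2 M p q = mat 2 2 (\<lambda>(i, j). M $$ (2 * (p - 1) + i, 2 * (q - 1) + j))"

definition mat2 :: "complex \<Rightarrow> complex \<Rightarrow> complex \<Rightarrow> complex \<Rightarrow> complex mat" where
  "mat2 a b c d = mat_of_rows_list 2 [[a, b], [c, d]]"

text \<open>The family of parameters is a function \<open>x\<close> on all pairs of indices. Only \<open>x 1 1\<close>, \<open>x 2 2\<close>,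
  \<open>x 2 3\<close>, \<open>x 1 i\<close>, \<open>x 1 (i + 1)\<close> with \<open>i = 2, 6, \<dots>, n - 3\<close> and \<open>x 2 j\<close>, \<open>x 2 (j + 1)\<close> with
  \<open>j = 6, 10, \<dots>, n - 3\<close> occur in the blocks with \<open>1 \<le> p, q \<le> (n + 1) / 2\<close>.\<close>

definition X11 :: "(nat \<Rightarrow> nat \<Rightarrow> complex) \<Rightarrow> complex mat" where
  "X11 x = mat2 0 0
                0 (x 1 1)"

definition X22 :: "(nat \<Rightarrow> nat \<Rightarrow> complex) \<Rightarrow> complex mat" where
  "X22 x = mat2 (x 2 2) (x 2 3)
                0       (- x 1 1)"

definition Y1 :: "(nat \<Rightarrow> nat \<Rightarrow> complex) \<Rightarrow> nat \<Rightarrow> complex mat" where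
  "Y1 x i = mat2 0       0
                 (x 1 i) (x 1 (i + 1))"

definition Y2 :: "(nat \<Rightarrow> nat \<Rightarrow> complex) \<Rightarrow> nat \<Rightarrow> complex mat" where
  "Y2 x j = mat2 (x 2 j) (x 2 (j + 1))
                 0       0"

definition solution_block :: "(nat \<Rightarrow> nat \<Rightarrow> complex) \<Rightarrow> nat \<Rightarrow> nat \<Rightarrow> complex mat" where
  "solution_block x p q =
    (if p = 1 \<and> q = 1 then X11 x
     else if p = q \<and> even p then X22 x
     else if p = q \<and> odd p \<and> p \<ge> 3 then - transpose_mat (X22 x)
     else if odd p \<and> even q \<and> p < q then Y1 x (2 * (q - p))
     else if odd p \<and> even q \<and> p > q then - transpose_mat (Y1 x (2 * (p - q)))
     else if even p \<and> even q \<and> p < q then Y2 x (2 * (q - p) + 2)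
     else if odd p \<and> odd q \<and> p > q \<and> q \<ge> 3 then - transpose_mat (Y2 x (2 * (p - q) + 2))
     else 0\<^sub>m 2 2)"

end

theory Submission
  imports Defs
begin

text \<open>Padding shifts the indices, so that the entry \<open>P a b\<close> of the padded matrix, counted from 0, is the
  entry \<open>(a, b)\<close> of \<open>X\<close>, counted from 1. In terms of \<open>P\<close> the equation says that
  \<open>P (a + 2) (b + 2) = - P b a\<close>, together with boundary conditions. This recursion determines \<open>P\<close> by its
  rows 1 and 2. Applied twice it gives \<open>P (a + 4) (b + 4) = P a b\<close>, so since \<open>n mod 4 = 1\<close> the zeros in
  the last two columns propagate to the entries of rows 1, 2 and 3 in all columns \<open>b > a\<close> with
  \<open>b mod 4 \<in> {0, 1}\<close>. In particular \<open>P 2 1 = - P 3 4 = 0\<close>, and the remaining entries of rows 1 and 2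
  outside column 0 are the free parameters. Conversely, the
  claimed family satisfies the recursion and the boundary conditions.\<close>

section \<open>The equation and the claimed family, entry by entry\<close>

definition pad_entry_solution :: "nat \<Rightarrow> (nat \<Rightarrow> nat \<Rightarrow> complex) \<Rightarrow> bool" where
  "pad_entry_solution n P \<longleftrightarrow>
     (\<forall>a\<le>n. P 0 a = 0 \<and> P a 0 = 0) \<and>
     (\<forall>a\<in>{1..n - 2}. \<forall>b\<in>{1..n - 2}. P (a + 2) (b + 2) = - P b a) \<and>
     (\<forall>a\<in>{3..n}. P a 1 = 0 \<and> P a 2 = 0) \<and>
     (\<forall>a\<in>{1..n - 2}. P a (n - 1) = 0 \<and> P a n = 0)"

text \<open>Residues modulo 4 encode the parity of the block index: a padded index is 0 or 1 modulo
  4 in an odd block, 2 or 3 in an even one. The entries \<open>x 2 2\<close> and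
  \<open>x 2 3\<close> of the diagonal blocks fall under the \<open>Y2\<close> cases, with index
  difference 0 or 1; \<open>4 \<le> b\<close> keeps the padding column zero.\<close>

definition solution_entry :: "(nat \<Rightarrow> nat \<Rightarrow> complex) \<Rightarrow> nat \<Rightarrow> nat \<Rightarrow> complex" where
  "solution_entry x a b =
    (if a = b \<and> a mod 4 = 1 then x 1 1
     else if a = b \<and> a mod 4 = 3 then - x 1 1
     else if a mod 4 = 1 \<and> b mod 4 \<in> {2, 3} \<and> a < b then x 1 (b - a + 1)
     else if a mod 4 \<in> {0, 1} \<and> b mod 4 = 3 \<and> b < a then - x 1 (a - b + 1)
     else if a mod 4 = 2 \<and> b mod 4 \<in> {2, 3} \<and> a \<le> b then x 2 (b - a + 2)
     else if a mod 4 \<in> {0, 1} \<and> b mod 4 = 0 \<and> 4 \<le> b \<and> b \<le> a then - x 2 (a - b + 2)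
     else 0)"

lemma mat2_index [simp]:
  "mat2 a b c d $$ (0, 0) = a" "mat2 a b c d $$ (0, Suc 0) = b"
  "mat2 a b c d $$ (Suc 0, 0) = c" "mat2 a b c d $$ (Suc 0, Suc 0) = d"
  "dim_row (mat2 a b c d) = 2" "dim_col (mat2 a b c d) = 2"
  by (auto simp: mat2_def mat_of_rows_list_def)

lemma solution_block_dims [simp]:
  "dim_row (solution_block x p q) = 2" "dim_col (solution_block x p q) = 2"
  by (auto simp: solution_block_def X11_def X22_def Y1_def Y2_def)

lemma solution_block_index:
  assumes "p \<ge> 1" "q \<ge> 1" "i < 2" "j < 2"
  shows "solution_block x p q $$ (i, j) = solution_entry x (2 * (p - 1) + i) (2 * (q - 1) + j)"
proof -
  \<comment> \<open>With k and l the parities of \<open>p - 1\<close> and \<open>q - 1\<close>, the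
    entry indices are \<open>4 * u + 2 * k + i\<close> and \<open>4 * v + 2 * l + j\<close>. The
    claim becomes a finite split over k, l, i, j and the order of u and v.\<close>
  define u v where "u = (p - 1) div 2" and "v = (q - 1) div 2"
  have "\<exists>k<2. p = 2 * u + 1 + k \<and> 2 * (p - 1) + i = 4 * u + 2 * k + i"
    "\<exists>l<2. q = 2 * v + 1 + l \<and> 2 * (q - 1) + j = 4 * v + 2 * l + j"
    using assms(1,2) unfolding u_def v_def by presburger+
  then obtain k l where
    k: "p = 2 * u + 1 + k" "2 * (p - 1) + i = 4 * u + 2 * k + i" "k = 0 \<or> k = 1" and
    l: "q = 2 * v + 1 + l" "2 * (q - 1) + j = 4 * v + 2 * l + j" "l = 0 \<or> l = 1"
    by (auto simp: less_2_cases_iff)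
  have ij: "i = 0 \<or> i = 1" "j = 0 \<or> j = 1"
    using assms(3,4) by auto
  have uv: "u = v \<or> u < v \<or> v < u" by auto
  have mods: "(4 * w) mod 4 = 0" "Suc (4 * w) mod 4 = 1" "Suc (Suc (4 * w)) mod 4 = 2"
      "Suc (Suc (Suc (4 * w))) mod 4 = 3" for w :: nat
    by presburger+
  \<comment> \<open>Subtraction truncates, so under \<open>t < s\<close> these bring the index of
    \<open>x\<close> computed from blocks and the one computed from entries to a common
    form.\<close>
  have diffs: "2 * (2 * s - 2 * t) = 4 * s - 4 * t"
      "2 * (Suc (2 * s) - 2 * t) = Suc (Suc (4 * s - 4 * t))"
      "2 * (2 * s - Suc (2 * t)) = Suc (4 * s - Suc (Suc (Suc (4 * t))))"
      "4 * s - Suc (Suc (4 * t)) = Suc (4 * s - Suc (Suc (Suc (4 * t))))"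
      "Suc (4 * s) - 4 * t = Suc (4 * s - 4 * t)"
      "Suc (Suc (4 * s)) - 4 * t = Suc (Suc (4 * s - 4 * t))"
    if "t < s" for s t :: nat
    using that by linarith+
  show ?thesis
    unfolding k(2) l(2) unfolding k(1) l(1)
    using k(3) l(3) ij uv
    by (elim disjE) (simp_all add: solution_block_def solution_entry_def X11_def X22_def Y1_def
        Y2_def mods diffs flip: numeral_2_eq_2)
qed

lemma pad_entry_solution_solution_entry:
  assumes "n mod 4 = 1"
  shows "pad_entry_solution n (solution_entry x)"
proof -
  \<comment> \<open>Transposing and shifting by 2 exchanges the nonzero cases in pairs of opposite
    sign: first with second, third with fourth, fifth with sixth. A positive multiple of 4 is at
    least 4, as the sixth case demands.\<close>
  have skew: "solution_entry x (a + 2) (b + 2) = - solution_entry x b a" if "a \<ge> 1" "b \<ge> 1" for a b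
  proof -
    have "a mod 4 = 0 \<and> (a + 2) mod 4 = 2 \<and> a \<ge> 4 \<or> a mod 4 = 1 \<and> (a + 2) mod 4 = 3
        \<or> a mod 4 = 2 \<and> (a + 2) mod 4 = 0 \<or> a mod 4 = 3 \<and> (a + 2) mod 4 = 1"
      "b mod 4 = 0 \<and> (b + 2) mod 4 = 2 \<and> b \<ge> 4 \<or> b mod 4 = 1 \<and> (b + 2) mod 4 = 3
        \<or> b mod 4 = 2 \<and> (b + 2) mod 4 = 0 \<or> b mod 4 = 3 \<and> (b + 2) mod 4 = 1"
      using that by presburger+
    then show ?thesis
      by (elim disjE) (auto simp: solution_entry_def)
  qed
  have "solution_entry x a (n - 1) = 0 \<and> solution_entry x a n = 0" if "a \<in> {1..n - 2}" for a
  proof -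
    \<comment> \<open>Columns \<open>n - 1\<close> and \<open>n\<close> have residues 0 and 1, and
      no nonzero case has such a column strictly above the diagonal.\<close>
    have "(n - 1) mod 4 = 0" "a < n - 1" using assms that by (presburger, auto)
    then show ?thesis using assms by (auto simp: solution_entry_def)
  qed
  with skew show ?thesis
    by (auto simp: pad_entry_solution_def solution_entry_def)
qed

section \<open>Solving the recursion\<close>

lemma pad_entry_solution_skew:
  assumes "pad_entry_solution n P" "1 \<le> a" "a + 2 \<le> n" "1 \<le> b" "b + 2 \<le> n"
  shows "P (a + 2) (b + 2) = - P b a"
  using assms by (auto simp: pad_entry_solution_def)

text \<open>The recursion leads from \<open>(a, b)\<close> to \<open>(b - 2, a - 2)\<close>. It
  swaps the indices, so the induction is on their sum. It stops in rows 1 and 2 or at an entry where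
  the boundary conditions give zero.\<close>

lemma pad_entry_solution_eqI:
  assumes P: "pad_entry_solution n P" and Q: "pad_entry_solution n Q"
    and rows: "\<And>b. b \<le> n \<Longrightarrow> P 1 b = Q 1 b" "\<And>b. b \<le> n \<Longrightarrow> P 2 b = Q 2 b"
    and "a \<le> n" "b \<le> n"
  shows "P a b = Q a b"
  using \<open>a \<le> n\<close> \<open>b \<le> n\<close>
proof (induction "a + b" arbitrary: a b rule: less_induct)
  case less
  consider "a = 0" | "a = 1" | "a = 2" | "b = 0" | "a \<ge> 3" "b = 1" | "a \<ge> 3" "b = 2" | "a \<ge> 3" "b \<ge> 3"
    by linarith
  then show ?case
  proof cases
    case 7
    have "R a b = - R (b - 2) (a - 2)" if "pad_entry_solution n R" for R
      using pad_entry_solution_skew[OF that, of "a - 2" "b - 2"] 7 less.prems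
      by (simp del: add_2_eq_Suc')
    moreover have "P (b - 2) (a - 2) = Q (b - 2) (a - 2)"
      using 7 less.prems by (intro less.hyps) auto
    ultimately show ?thesis
      using P Q by metis
  qed (use P Q rows less.prems in \<open>auto simp: pad_entry_solution_def\<close>)
qed

text \<open>A double step of the recursion moves along the diagonal by 4 and preserves the residues,
  so it ends in column \<open>n - 1\<close> or \<open>n\<close>.\<close>

lemma pad_entry_solution_above_diagonal:
  assumes "n mod 4 = 1" and P: "pad_entry_solution n P"
    and "a mod 4 \<noteq> 0" "a < b" "b \<le> n" "b mod 4 \<in> {0, 1}"
  shows "P a b = 0"
  using assms(3-)
proof (induction "n - b" arbitrary: a b rule: less_induct)
  case less
  show ?case
  proof (cases "b + 1 \<ge> n")
    case True
    then have "b = n - 1 \<or> b = n" using less.prems by auto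
    \<comment> \<open>The residue condition on a excludes row 0 and, for \<open>b = n\<close>, row
      \<open>n - 1\<close>, to which the zero condition on the last columns does not extend.\<close>
    moreover have "a \<in> {1..n - 2}"
    proof -
      have "(n - 1) mod 4 = 0" "n \<ge> 1" "a \<noteq> 0" "a \<noteq> n - 1"
        using assms(1) less.prems(1) by presburger+
      then show ?thesis using less.prems True by auto
    qed
    ultimately show ?thesis
      using P by (auto simp: pad_entry_solution_def)
  next
    case False
    have "b mod 4 = 0 \<or> b mod 4 = 1" using less.prems by simp
    \<comment> \<open>Here b is below \<open>n - 1\<close> and congruent to \<open>n - 1\<close> or
      \<open>n\<close> modulo 4, so a double step stays inside the matrix.\<close>
    with False assms(1) have "b + 4 \<le> n" by presburger
    moreover have "1 \<le> a" using less.prems by (cases a) auto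
    ultimately have "P (b + 2) (a + 2) = - P a b"
      using less.prems by (intro pad_entry_solution_skew[OF P]) auto
    moreover have "P (a + 2 + 2) (b + 2 + 2) = - P (b + 2) (a + 2)"
      using less.prems \<open>b + 4 \<le> n\<close> by (intro pad_entry_solution_skew[OF P]) auto
    moreover have "P (a + 2 + 2) (b + 2 + 2) = 0"
      using less.prems \<open>b + 4 \<le> n\<close> by (intro less.hyps) auto
    ultimately show ?thesis by simp
  qed
qed

lemma pad_entry_solution_iff:
  assumes "n mod 4 = 1" "n \<ge> 5"
  shows "pad_entry_solution n P \<longleftrightarrow> (\<exists>x. \<forall>a\<le>n. \<forall>b\<le>n. P a b = solution_entry x a b)"
proof
  assume P: "pad_entry_solution n P"
  note zero = pad_entry_solution_above_diagonal[OF assms(1) P]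
  have b_mod: "b = 0 \<or> b = 1 \<or> 4 \<le> b \<and> b mod 4 \<in> {0, 1} \<or> 1 < b \<and> b mod 4 = 2 \<or> 2 < b \<and> b mod 4 = 3"
    for b :: nat
    by (simp; presburger)
  \<comment> \<open>\<open>P\<close> itself serves as the parameter family: in rows 1 and 2 the
    parameter index is the column, so the free entries return themselves.\<close>
  have row1: "P 1 b = solution_entry P 1 b" if "b \<le> n" for b
    using b_mod[of b] P that assms zero[of 1 b]
    by (elim disjE) (auto simp: solution_entry_def pad_entry_solution_def)
  \<comment> \<open>The boundary conditions cover column 1 only from row 3 on, and
    \<open>zero\<close> only entries above the diagonal; one recursion step brings
    \<open>P 2 1\<close> there.\<close>
  have "P 3 4 = - P 2 1"
    using assms(2) pad_entry_solution_skew[OF P, of 1 2] by (simp add: eval_nat_numeral)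
  moreover have "P 3 4 = 0"
    using zero[of 3 4] assms(2) by simp
  ultimately have "P 2 1 = 0" by simp
  then have row2: "P 2 b = solution_entry P 2 b" if "b \<le> n" for b
    using b_mod[of b] P that assms zero[of 2 b]
    by (elim disjE) (auto simp: solution_entry_def pad_entry_solution_def Suc_diff_Suc numeral_2_eq_2)
  show "\<exists>x. \<forall>a\<le>n. \<forall>b\<le>n. P a b = solution_entry x a b"
    using pad_entry_solution_eqI[OF P pad_entry_solution_solution_entry[OF assms(1)] row1 row2]
    by blast
next
  assume "\<exists>x. \<forall>a\<le>n. \<forall>b\<le>n. P a b = solution_entry x a b"
  then obtain x where x: "\<And>a b. a \<le> n \<Longrightarrow> b \<le> n \<Longrightarrow> P a b = solution_entry x a b"
    by blast
  show "pad_entry_solution n P"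
    using pad_entry_solution_solution_entry[OF assms(1), of x] assms(2)
    unfolding pad_entry_solution_def by (auto simp: x)
qed

section \<open>From the matrix equation to the recursion\<close>

lemma pad_entry_solution_iff_equations:
  assumes "n \<ge> 4" and zero: "\<And>a. a \<le> n \<Longrightarrow> P 0 a = 0 \<and> P a 0 = 0"
  shows "pad_entry_solution n P \<longleftrightarrow>
    (\<forall>a\<in>{1..n}. \<forall>b\<in>{1..n}.
      (if 3 \<le> b then P (b - 2) a else 0) + (if a + 2 \<le> n then P (a + 2) b else 0) = 0)"
    (is "_ \<longleftrightarrow> (\<forall>a\<in>{1..n}. \<forall>b\<in>{1..n}. ?E a b = 0)")
proof
  assume P: "pad_entry_solution n P"
  show "\<forall>a\<in>{1..n}. \<forall>b\<in>{1..n}. ?E a b = 0"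
  proof (intro ballI)
    fix a b
    assume ab: "a \<in> {1..n}" "b \<in> {1..n}"
    \<comment> \<open>The first summand comes from X^t A^2 and is absent in columns 1 and 2; the
      second comes from A^2 X and is absent in rows \<open>n - 1\<close> and \<open>n\<close>. Where
      both occur the equation is the recursion; where just one does, it is a boundary
      condition.\<close>
    consider "b \<ge> 3" "a + 2 \<le> n" | "b \<ge> 3" "a = n - 1 \<or> a = n" | "b = 1 \<or> b = 2"
      using ab by fastforce
    then show "?E a b = 0"
    proof cases
      case 1
      then have "P (a + 2) (b - 2 + 2) = - P (b - 2) a"
        using ab by (intro pad_entry_solution_skew[OF P]) auto
      moreover have "b - 2 + 2 = b" using 1 by simp
      ultimately have "P (a + 2) b = - P (b - 2) a" by metis
      then show ?thesis using 1 by (simp del: add_2_eq_Suc')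
    next
      case 2
      then have "b - 2 \<in> {1..n - 2}" using ab by auto
      then have "P (b - 2) a = 0" using 2 P by (auto simp: pad_entry_solution_def)
      then show ?thesis using 2 assms(1) by auto
    next
      case 3
      then show ?thesis using P ab by (auto simp: pad_entry_solution_def)
    qed
  qed
next
  assume "\<forall>a\<in>{1..n}. \<forall>b\<in>{1..n}. ?E a b = 0"
  then have E: "?E a b = 0" if "1 \<le> a" "a \<le> n" "1 \<le> b" "b \<le> n" for a b
    using that by auto
  have "P (a + 2) (b + 2) = - P b a" if "a \<in> {1..n - 2}" "b \<in> {1..n - 2}" for a b
  proof -
    have "1 \<le> a" "a + 2 \<le> n" "a \<le> n" "b + 2 \<le> n" "1 \<le> b"
      using that assms(1) by auto
    then have "P b a + P (a + 2) (b + 2) = 0"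
      using E[of a "b + 2"] by (simp del: add_2_eq_Suc' add_2_eq_Suc)
    then show ?thesis
      by (simp add: eq_neg_iff_add_eq_0 add.commute)
  qed
  moreover have "P a 1 = 0" "P a 2 = 0" if "a \<in> {3..n}" for a
  proof -
    have "a - 2 + 2 = a" "1 \<le> a - 2" using that by auto
    then show "P a 1 = 0" "P a 2 = 0"
      using E[of "a - 2" 1] E[of "a - 2" 2] that assms(1) by auto
  qed
  moreover have "P a (n - 1) = 0" "P a n = 0" if "a \<in> {1..n - 2}" for a
    using E[of "n - 1" "a + 2"] E[of n "a + 2"] that assms(1) by auto
  ultimately show "pad_entry_solution n P"
    using zero by (simp add: pad_entry_solution_def)
qed

lemma shift_mat_square:
  "shift_mat n ^\<^sub>m 2 = mat n n (\<lambda>(i, j). if j = i + 2 then 1 else 0)"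
proof (rule eq_matI)
  fix i j
  assume "i < dim_row (mat n n (\<lambda>(i, j). if j = i + 2 then 1 else 0 :: complex))"
    "j < dim_col (mat n n (\<lambda>(i, j). if j = i + 2 then 1 else 0 :: complex))"
  then have ij: "i < n" "j < n" by auto
  have "(shift_mat n ^\<^sub>m 2) $$ (i, j) =
      (\<Sum>k = 0..<n. (if k = i + 1 then 1 else 0) * (if j = k + 1 then 1 else 0))"
    using ij by (simp add: numeral_2_eq_2 shift_mat_def scalar_prod_def)
  also have "\<dots> = (\<Sum>k = 0..<n. if k = i + 1 then if j = i + 2 then 1 else 0 else 0)"
    by (intro sum.cong) auto
  also have "\<dots> = (if j = i + 2 then 1 else 0)"
    using ij by simp
  finally show "(shift_mat n ^\<^sub>m 2) $$ (i, j) = mat n n (\<lambda>(i, j). if j = i + 2 then 1 else 0) $$ (i, j)"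
    using ij by simp
qed (auto simp: shift_mat_def numeral_2_eq_2)

lemma transpose_mult_shift_index:
  assumes "X \<in> carrier_mat n n" "i < n" "j < n"
  shows "(transpose_mat X * (shift_mat n ^\<^sub>m 2) + (shift_mat n ^\<^sub>m 2) * X) $$ (i, j) =
    (if 2 \<le> j then X $$ (j - 2, i) else 0) + (if i + 2 < n then X $$ (i + 2, j) else 0)"
proof -
  have "(transpose_mat X * (shift_mat n ^\<^sub>m 2)) $$ (i, j) =
      (\<Sum>k = 0..<n. X $$ (k, i) * (if j = k + 2 then 1 else 0))"
    using assms by (simp add: shift_mat_square scalar_prod_def)
  \<comment> \<open>For \<open>j < 2\<close> the difference \<open>j - 2\<close> truncates to the
    valid index 0, so the inner guard must kill that term.\<close>
  also have "\<dots> = (\<Sum>k = 0..<n. if k = j - 2 then if 2 \<le> j then X $$ (j - 2, i) else 0 else 0)"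
    by (intro sum.cong) auto
  also have "\<dots> = (if 2 \<le> j then X $$ (j - 2, i) else 0)"
    using assms by auto
  finally have left: "(transpose_mat X * (shift_mat n ^\<^sub>m 2)) $$ (i, j) = \<dots>" .
  have "((shift_mat n ^\<^sub>m 2) * X) $$ (i, j) = (\<Sum>k = 0..<n. (if k = i + 2 then 1 else 0) * X $$ (k, j))"
    using assms by (simp add: shift_mat_square scalar_prod_def)
  also have "\<dots> = (\<Sum>k = 0..<n. if k = i + 2 then X $$ (i + 2, j) else 0)"
    by (intro sum.cong) auto
  also have "\<dots> = (if i + 2 < n then X $$ (i + 2, j) else 0)"
    by simp
  finally show ?thesis
    using left assms by (simp add: shift_mat_square)
qed

lemma pad_mat_index:
  assumes "X \<in> carrier_mat n n" "a \<le> n" "b \<le> n"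
  shows "pad_mat n X $$ (a, b) = (if a = 0 \<or> b = 0 then 0 else X $$ (a - 1, b - 1))"
  using assms by (auto simp: pad_mat_def)

lemma equation_iff_pad_entry_solution:
  assumes X: "X \<in> carrier_mat n n" and "n \<ge> 4"
  shows "transpose_mat X * (shift_mat n ^\<^sub>m 2) + (shift_mat n ^\<^sub>m 2) * X = 0\<^sub>m n n \<longleftrightarrow>
    pad_entry_solution n (\<lambda>a b. pad_mat n X $$ (a, b))" (is "?L \<longleftrightarrow> pad_entry_solution n ?P")
proof -
  define E where "E a b = (if 3 \<le> b then ?P (b - 2) a else 0) + (if a + 2 \<le> n then ?P (a + 2) b else 0)"
    for a b
  have E: "(transpose_mat X * (shift_mat n ^\<^sub>m 2) + (shift_mat n ^\<^sub>m 2) * X) $$ (a - 1, b - 1) = E a b"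
    if "a \<in> {1..n}" "b \<in> {1..n}" for a b
  proof -
    have "b - 1 - 2 = b - 2 - 1" "a - 1 + 2 = a + 2 - 1" using that by auto
    then show ?thesis
      using that transpose_mult_shift_index[OF X, of "a - 1" "b - 1"]
      by (auto simp: E_def pad_mat_index[OF X])
  qed
  have "?L \<longleftrightarrow> (\<forall>i<n. \<forall>j<n.
      (transpose_mat X * (shift_mat n ^\<^sub>m 2) + (shift_mat n ^\<^sub>m 2) * X) $$ (i, j) = 0)"
    using X by (auto simp: mat_eq_iff shift_mat_square)
  also have "\<dots> \<longleftrightarrow> (\<forall>a\<in>{1..n}. \<forall>b\<in>{1..n}. E a b = 0)" (is "?A \<longleftrightarrow> ?B")
  proof
    assume ?A
    show ?B
    proof (intro ballI)
      fix a b
      assume "a \<in> {1..n}" "b \<in> {1..n}"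
      then have "a - 1 < n" "b - 1 < n" "E a b =
          (transpose_mat X * (shift_mat n ^\<^sub>m 2) + (shift_mat n ^\<^sub>m 2) * X) $$ (a - 1, b - 1)"
        using E[of a b] by auto
      with \<open>?A\<close> show "E a b = 0" by metis
    qed
  next
    assume ?B
    show ?A
    proof (intro allI impI)
      fix i j
      assume "i < n" "j < n"
      with \<open>?B\<close> E[of "i + 1" "j + 1"]
      show "(transpose_mat X * (shift_mat n ^\<^sub>m 2) + (shift_mat n ^\<^sub>m 2) * X) $$ (i, j) = 0"
        by simp
    qed
  qed
  also have "\<dots> \<longleftrightarrow> pad_entry_solution n ?P"
    unfolding E_def using assms(2)
    by (intro pad_entry_solution_iff_equations[symmetric]) (simp_all add: pad_mat_index[OF X])
  finally show ?thesis .
qed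

section \<open>Reassembling the blocks\<close>

lemma blocks_eq_iff_entries_eq:
  assumes "2 * m = Suc n"
  shows "(\<forall>p\<in>{1..m}. \<forall>q\<in>{1..m}. block2 M p q = solution_block x p q) \<longleftrightarrow>
    (\<forall>a\<le>n. \<forall>b\<le>n. M $$ (a, b) = solution_entry x a b)" (is "?L \<longleftrightarrow> ?R")
proof
  assume L: ?L
  show ?R
  proof (intro allI impI)
    fix a b
    assume "a \<le> n" "b \<le> n"
    \<comment> \<open>The padded matrix has even order \<open>2 * m\<close>, so the blocks tile it
      exactly: quotients by 2 locate the block, remainders the entry in it.\<close>
    then have "a div 2 + 1 \<in> {1..m}" "b div 2 + 1 \<in> {1..m}"
      using assms by auto
    with L have "block2 M (a div 2 + 1) (b div 2 + 1) $$ (a mod 2, b mod 2) =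
        solution_block x (a div 2 + 1) (b div 2 + 1) $$ (a mod 2, b mod 2)"
      by simp
    then show "M $$ (a, b) = solution_entry x a b"
      by (simp add: solution_block_index block2_def)
  qed
next
  assume R: ?R
  show ?L
  proof (intro ballI)
    fix p q
    assume "p \<in> {1..m}" "q \<in> {1..m}"
    then show "block2 M p q = solution_block x p q"
      using R assms by (intro eq_matI) (auto simp: block2_def solution_block_index)
  qed
qed

theorem proposition5p8:
  fixes n m :: nat and X :: "complex mat"
  assumes "n mod 4 = 1" and "n \<ge> 5" and "m = (n + 1) div 2"
    and "X \<in> carrier_mat n n"
  shows "transpose_mat X * (shift_mat n ^\<^sub>m 2) + (shift_mat n ^\<^sub>m 2) * X = 0\<^sub>m n n \<longleftrightarrow>
    (\<exists>x :: nat \<Rightarrow> nat \<Rightarrow> complex. \<forall>p\<in>{1..m}. \<forall>q\<in>{1..m}.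
       block2 (pad_mat n X) p q = solution_block x p q)"
proof -
  have "2 * m = Suc n"
    using assms(1,3) by presburger
  then show ?thesis
    using assms(2,4) pad_entry_solution_iff[OF assms(1,2)]
    by (simp only: equation_iff_pad_entry_solution blocks_eq_iff_entries_eq)
qed

end
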